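(* Let $\mu$ be a probability measure on $\mathbb{R}^d$ that is absolutely continuous with respect to Lebesgue measure, let $t>0$, and let $\eta$ be a Poisson point process on $\mathbb{R}^d$ with intensity measure $t\mu$. Let $\Pi_t$ be the convex hull of the points of $\eta$, and let $I(\Pi_t)$ be the number of points of $\eta$ lying in the interior of $\Pi_t$. Let $\kappa_k(\mu(\Pi_t))$ and $\kappa_k(I(\Pi_t))$ denote the $k$-th cumulants of the random variables $\mu(\Pi_t)$ and $I(\Pi_t)$. Then for every $k\in\mathbb{N}$, $$t^k\kappa_k(\mu(\Pi_t))=\sum_{j=1}^k \begin{bmatrix} k\\ j\end{bmatrix}\kappa_j(I(\Pi_t)).$$
   Context: The cumulants $\kappa_k(X)$ of a random variable $X$ are defined by $\ln \mathbb{E}\, e^{zX}=\sum_{k\ge1}\kappa_k(X)\frac{z^k}{k!}$. The (signed) Stirling numbers of the first kind $\begin{bmatrix} n\\ k\end{bmatrix}$ are defined by $z(z-1)\cdots(z-n+1)=\sum_{k=1}^n \begin{bmatrix} n\\ k\end{bmatrix} z^k$; equivalently $\frac{\ln^j(z+1)}{j!}=\sum_{k\ge j}\begin{bmatrix} k\\ j\end{bmatrix}\frac{z^k}{k!}$. A Poisson point process $\eta$ with intensity measure $t\mu$ is a random finite simple counting measure such that $\eta(A)$ is Poisson distributed with parameter $t\mu(A)$ and counts of disjoint sets are independent. *)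

theory Defs
  imports "HOL-Probability.Probability" "HOL-Computational_Algebra.Polynomial"
begin

definition cumulant :: "'w measure \<Rightarrow> ('w \<Rightarrow> real) \<Rightarrow> nat \<Rightarrow> real" where
  "cumulant M X k = (deriv ^^ k) (\<lambda>z. ln (\<integral>\<omega>. exp (z * X \<omega>) \<partial>M)) 0"

definition stirling1_signed :: "nat \<Rightarrow> nat \<Rightarrow> int" where
  "stirling1_signed n k = coeff (\<Prod>i<n. [:- of_nat i, 1:]) k"

text \<open>Poisson point process with intensity measure t\<mu>, realised as a random
  finite set of points (a simple finite counting measure) \<eta> on the probability space M.\<close>
definition poisson_point_process ::
  "'w measure \<Rightarrow> 'a::euclidean_space measure \<Rightarrow> real \<Rightarrow> ('w \<Rightarrow> 'a set) \<Rightarrow> bool" where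
  "poisson_point_process M \<mu> t \<eta> \<longleftrightarrow>
     (\<forall>\<omega>\<in>space M. finite (\<eta> \<omega>)) \<and>
     (\<forall>A\<in>sets borel.
        (\<lambda>\<omega>. card (\<eta> \<omega> \<inter> A)) \<in> measurable M (count_space UNIV) \<and>
        (\<forall>n::nat. measure M {\<omega>\<in>space M. card (\<eta> \<omega> \<inter> A) = n}
                   = exp (- (t * measure \<mu> A)) * (t * measure \<mu> A) ^ n / fact n)) \<and>
     (\<forall>(I::nat set) A. finite I \<longrightarrow> disjoint_family_on A I \<longrightarrow> (\<forall>i\<in>I. A i \<in> sets borel) \<longrightarrow>
        prob_space.indep_vars M (\<lambda>_. count_space UNIV) (\<lambda>i \<omega>. card (\<eta> \<omega> \<inter> A i)) I)"

end

theory Submission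
  imports Defs "HOL-Real_Asymp.Real_Asymp"
begin

text \<open>
  Conditionally on the vertices of the hull, the points of the process in its interior form a
  Poisson process, so that \<open>E exp (w I) = E exp (t (exp w - 1) V)\<close> for the number \<open>I\<close> of interior
  points, the content \<open>V\<close> of the hull and all real \<open>w\<close>. To see this from the independence of
  counts alone, cut the space into finitely many small cells and call a cell absorbed if it lies in
  the interior of the hull of the other occupied cells, however their points are placed. Making an
  absorbed cell occupied or empty does not change the set of absorbed cells, because interior
  points can be dropped from a finite set without changing its hull. Hence the set of absorbed
  cells is independent of the counts in them, which gives the identity for the absorbed cells; it
  passes to the limit as the mesh shrinks.

  The logarithm of the identity says \<open>K\<^sub>I(w) = K\<^sub>V(t (exp w - 1))\<close>. The functions
  \<open>L\<^sub>k(w) = exp (k w) t\<^sup>k K\<^sub>V\<^sup>(\<^sup>k\<^sup>)(t (exp w - 1))\<close> satisfy \<open>L\<^sub>k\<^sub>+\<^sub>1 = L\<^sub>k' - k L\<^sub>k\<close>, which is the recursion of the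
  Stirling numbers, so \<open>L\<^sub>k\<close> is the Stirling combination of the derivatives of \<open>L\<^sub>0 = K\<^sub>I\<close>.
\<close>

section \<open>Iterated derivatives and Stirling numbers\<close>

text \<open>\<open>deriv\<close> is total, so \<open>deriv ^^ n\<close> says nothing about
  existence. Here each derivative is handed over as a function on the whole line, ready for
  induction.\<close>

primrec times_differentiable :: "nat \<Rightarrow> (real \<Rightarrow> real) \<Rightarrow> bool" where
  "times_differentiable 0 f \<longleftrightarrow> True"
| "times_differentiable (Suc n) f \<longleftrightarrow>
     (\<exists>f'. (\<forall>x. (f has_real_derivative f' x) (at x)) \<and> times_differentiable n f')"

lemma times_differentiable_SucD:
  "times_differentiable (Suc n) f \<Longrightarrow> times_differentiable n f"
  by (induction n arbitrary: f) (auto simp del: times_differentiable.simps(2), auto)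

lemma times_differentiable_add:
  "times_differentiable n f \<Longrightarrow> times_differentiable n g \<Longrightarrow> times_differentiable n (\<lambda>x. f x + g x)"
proof (induction n arbitrary: f g)
  case (Suc n)
  then obtain f' g' where "\<forall>x. (f has_real_derivative f' x) (at x)" "times_differentiable n f'"
    "\<forall>x. (g has_real_derivative g' x) (at x)" "times_differentiable n g'" by auto
  then show ?case using Suc.IH[of f' g'] by (auto intro!: exI[of _ "\<lambda>x. f' x + g' x"] DERIV_add)
qed simp

lemma times_differentiable_minus:
  "times_differentiable n f \<Longrightarrow> times_differentiable n (\<lambda>x. - f x)"
proof (induction n arbitrary: f)
  case (Suc n)
  then obtain f' where "\<forall>x. (f has_real_derivative f' x) (at x)" "times_differentiable n f'" by auto
  then show ?case using Suc.IH[of f'] by (auto intro!: exI[of _ "\<lambda>x. - f' x"] DERIV_minus)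
qed simp

lemma times_differentiable_mult:
  "times_differentiable n f \<Longrightarrow> times_differentiable n g \<Longrightarrow> times_differentiable n (\<lambda>x. f x * g x)"
proof (induction n arbitrary: f g)
  case (Suc n)
  then obtain f' g' where *: "\<And>x. (f has_real_derivative f' x) (at x)" "times_differentiable n f'"
    "\<And>x. (g has_real_derivative g' x) (at x)" "times_differentiable n g'" by auto
  have "times_differentiable n (\<lambda>x. f' x * g x + f x * g' x)"
    using Suc.prems[THEN times_differentiable_SucD] *
    by (intro times_differentiable_add Suc.IH)
  moreover have "((\<lambda>x. f x * g x) has_real_derivative f' x * g x + f x * g' x) (at x)" for x
    using DERIV_mult[OF *(1)[of x] *(3)[of x]] by (simp add: mult_ac)
  ultimately show ?case by (auto intro!: exI[of _ "\<lambda>x. f' x * g x + f x * g' x"])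
qed simp

lemma times_differentiable_inverse:
  assumes "\<And>x. f x \<noteq> 0"
  shows "times_differentiable n f \<Longrightarrow> times_differentiable n (\<lambda>x. inverse (f x))"
proof (induction n)
  case (Suc n)
  then obtain f' where *: "\<And>x. (f has_real_derivative f' x) (at x)" "times_differentiable n f'" by auto
  have "times_differentiable n (\<lambda>x. - (inverse (f x) * f' x * inverse (f x)))"
    using Suc.IH[OF Suc.prems[THEN times_differentiable_SucD]] *
    by (intro times_differentiable_minus times_differentiable_mult)
  moreover have "((\<lambda>x. inverse (f x)) has_real_derivative - (inverse (f x) * f' x * inverse (f x))) (at x)" for x
    by (intro DERIV_inverse' *(1) assms)
  ultimately show ?case by (auto intro!: exI[of _ "\<lambda>x. - (inverse (f x) * f' x * inverse (f x))"])
qed simp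

lemma times_differentiable_ln:
  assumes "\<And>x. f x > 0" "times_differentiable n f"
  shows "times_differentiable n (\<lambda>x. ln (f x))"
proof (cases n)
  case (Suc m)
  then obtain f' where *: "\<And>x. (f has_real_derivative f' x) (at x)" "times_differentiable m f'"
    using assms by auto
  have "f x \<noteq> 0" for x using assms(1)[of x] by simp
  then have "times_differentiable m (\<lambda>x. inverse (f x) * f' x)"
    using times_differentiable_SucD[of m f] assms(2) * Suc
    by (intro times_differentiable_mult times_differentiable_inverse) simp_all
  moreover have "((\<lambda>x. ln (f x)) has_real_derivative inverse (f x) * f' x) (at x)" for x
    using DERIV_chain2[OF DERIV_ln[OF assms(1)] *(1)] by simp
  ultimately show ?thesis using Suc by (auto intro!: exI[of _ "\<lambda>x. inverse (f x) * f' x"])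
qed simp

text \<open>Termwise differentiation replaces \<open>c\<close> by \<open>diffs c\<close>, so the
  coefficients vary in the induction.\<close>

lemma times_differentiable_powser:
  fixes c :: "nat \<Rightarrow> real"
  shows "(\<And>y. summable (\<lambda>n. c n * y ^ n)) \<Longrightarrow> times_differentiable m (\<lambda>x. \<Sum>n. c n * x ^ n)"
proof (induction m arbitrary: c)
  case (Suc m)
  have "((\<lambda>x. \<Sum>n. c n * x ^ n) has_real_derivative (\<Sum>n. diffs c n * x ^ n)) (at x)" for x
    using termdiffs_strong_converges_everywhere[OF Suc.prems] .
  moreover have "summable (\<lambda>n. diffs c n * y ^ n)" for y
    by (rule termdiff_converges_all[OF Suc.prems])
  ultimately show ?case
    using Suc.IH[of "diffs c"] by (auto intro!: exI[of _ "\<lambda>x. \<Sum>n. diffs c n * x ^ n"])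
qed simp

text \<open>Carries existence of derivatives over to \<open>deriv\<close>, the operator in which
  cumulants are defined.\<close>

lemma higher_deriv_has_derivative:
  "times_differentiable (Suc n) f \<Longrightarrow>
    ((deriv ^^ n) f has_real_derivative (deriv ^^ Suc n) f x) (at x)"
proof (induction n arbitrary: f)
  case 0
  then obtain f' where *: "\<And>x. (f has_real_derivative f' x) (at x)" by auto
  then have "deriv f = f'" using DERIV_imp_deriv by blast
  then show ?case using * by simp
next
  case (Suc n)
  then obtain f' where *: "\<And>x. (f has_real_derivative f' x) (at x)" "times_differentiable (Suc n) f'"
    by auto
  have "deriv f = f'" using *(1) DERIV_imp_deriv by blast
  then have "(deriv ^^ Suc m) f = (deriv ^^ m) f'" for m by (simp only: funpow_Suc_right comp_apply)
  then show ?case using Suc.IH[OF *(2)] by presburger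
qed

section \<open>Stirling numbers as coefficients of iterated differential operators\<close>

lemma stirling1_signed_Suc:
  "stirling1_signed (Suc n) k =
    (if k = 0 then 0 else stirling1_signed n (k - 1)) - int n * stirling1_signed n k"
  by (cases k) (auto simp: stirling1_signed_def lessThan_Suc mult.commute[of "prod _ _"] coeff_pCons)

lemma stirling1_signed_0_right: "n \<ge> 1 \<Longrightarrow> stirling1_signed n 0 = 0"
  by (induction n rule: dec_induct) (simp add: stirling1_signed_def, simp add: stirling1_signed_Suc)

lemma stirling1_signed_eq_0: "n < k \<Longrightarrow> stirling1_signed n k = 0"
  by (induction n arbitrary: k) (auto simp: stirling1_signed_Suc, simp add: stirling1_signed_def)

text \<open>With D for differentiation the hypothesis reads \<open>L (Suc k)\<close> = (D - k)
  \<open>L k\<close>, so \<open>L k\<close> = D (D - 1) ... (D - k + 1) \<open>L 0\<close>.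
  Expanding the falling factorial in powers of D produces the Stirling numbers.\<close>

lemma stirling_inversion_deriv:
  fixes L :: "nat \<Rightarrow> real \<Rightarrow> real"
  assumes L: "\<And>k x. (L k has_real_derivative of_nat k * L k x + L (Suc k) x) (at x)"
  shows "L k x = (\<Sum>j\<le>k. of_int (stirling1_signed k j) * (deriv ^^ j) (L 0) x)"
proof -
  \<comment> \<open>Differentiation maps the span of \<open>L 0\<close>, ..., \<open>L j\<close>
    into that of \<open>L 0\<close>, ..., \<open>L (Suc j)\<close>. Hence each iterated derivative
    of \<open>L 0\<close> is differentiable again, as \<open>d\<close> records.\<close>
  have ex: "\<exists>a. (deriv ^^ j) (L 0) = (\<lambda>x. \<Sum>i\<le>j. a i * L i x)" for j
  proof (induction j)
    case 0
    show ?case by (rule exI[of _ "\<lambda>_. 1"]) auto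
  next
    case (Suc j)
    then obtain a where a: "(deriv ^^ j) (L 0) = (\<lambda>x. \<Sum>i\<le>j. a i * L i x)" by blast
    \<comment> \<open>The first summand collects the terms \<open>of_nat i * L i\<close>, the second
      the terms \<open>L (Suc i)\<close> after an index shift.\<close>
    define b where "b i = (if i \<le> j then a i * of_nat i else 0) + (if i = 0 then 0 else a (i - 1))" for i
    have "deriv (\<lambda>x. \<Sum>i\<le>j. a i * L i x) x = (\<Sum>i\<le>j. a i * (of_nat i * L i x + L (Suc i) x))" for x
      by (intro DERIV_imp_deriv DERIV_sum DERIV_cmult L)
    also have "(\<Sum>i\<le>j. a i * (of_nat i * L i x + L (Suc i) x)) = (\<Sum>i\<le>Suc j. b i * L i x)" for x
    proof -
      have "(\<Sum>i\<le>Suc j. (if i \<le> j then a i * of_nat i else 0) * L i x) = (\<Sum>i\<le>j. a i * of_nat i * L i x)"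
        by simp
      moreover have "(\<Sum>i\<le>Suc j. (if i = 0 then 0 else a (i - 1)) * L i x) = (\<Sum>i\<le>j. a i * L (Suc i) x)"
        by (subst sum.atMost_Suc_shift) simp
      ultimately show ?thesis
        by (simp add: b_def distrib_right sum.distrib algebra_simps del: sum.atMost_Suc)
    qed
    finally show ?case using a by (auto intro!: exI[of _ b] ext)
  qed
  have d: "((deriv ^^ j) (L 0) has_real_derivative (deriv ^^ Suc j) (L 0) x) (at x)" for j x
  proof -
    obtain a where a: "(deriv ^^ j) (L 0) = (\<lambda>x. \<Sum>i\<le>j. a i * L i x)" using ex by blast
    have "((\<lambda>x. \<Sum>i\<le>j. a i * L i x) has_real_derivative (\<Sum>i\<le>j. a i * (of_nat i * L i x + L (Suc i) x))) (at x)"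
      by (intro DERIV_sum DERIV_cmult L)
    then show ?thesis using a DERIV_imp_deriv[of "(deriv ^^ j) (L 0)"] by simp
  qed
  show ?thesis
  proof (induction k arbitrary: x)
    case 0
    show ?case by (simp add: stirling1_signed_def)
  next
    case (Suc k)
    let ?s = "\<lambda>j. real_of_int (stirling1_signed k j)" and ?D = "\<lambda>j. (deriv ^^ j) (L 0)"
    have "L k = (\<lambda>x. \<Sum>j\<le>k. ?s j * ?D j x)" using Suc by blast
    moreover have "((\<lambda>x. \<Sum>j\<le>k. ?s j * ?D j x) has_real_derivative (\<Sum>j\<le>k. ?s j * ?D (Suc j) x)) (at x)"
      by (intro DERIV_sum DERIV_cmult d)
    ultimately have "of_nat k * L k x + L (Suc k) x = (\<Sum>j\<le>k. ?s j * ?D (Suc j) x)"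
      using DERIV_unique[OF L[of k x]] by simp
    then have "L (Suc k) x = (\<Sum>j\<le>k. ?s j * ?D (Suc j) x) - (\<Sum>j\<le>k. of_nat k * ?s j * ?D j x)"
      using Suc[of x] by (simp add: sum_distrib_left mult_ac)
    also have "(\<Sum>j\<le>k. ?s j * ?D (Suc j) x) = (\<Sum>j\<le>Suc k. (if j = 0 then 0 else ?s (j - 1)) * ?D j x)"
      by (subst sum.atMost_Suc_shift) simp
    \<comment> \<open>The added term vanishes because \<open>stirling1_signed k (Suc k)\<close> is
      0.\<close>
    also have "(\<Sum>j\<le>k. of_nat k * ?s j * ?D j x) = (\<Sum>j\<le>Suc k. of_nat k * ?s j * ?D j x)"
      by (simp add: stirling1_signed_eq_0)
    also have "(\<Sum>j\<le>Suc k. (if j = 0 then 0 else ?s (j - 1)) * ?D j x) - (\<Sum>j\<le>Suc k. of_nat k * ?s j * ?D j x)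
       = (\<Sum>j\<le>Suc k. of_int (stirling1_signed (Suc k) j) * ?D j x)"
      unfolding sum_subtractf[symmetric]
      by (intro sum.cong) (auto simp: stirling1_signed_Suc algebra_simps)
    finally show ?case .
  qed
qed

text \<open>Differentiating \<open>exp w ^ k\<close> gives the term \<open>of_nat k * L k\<close>,
  differentiating the inner function gives \<open>L (Suc k)\<close>. At \<open>w = 0\<close> the
  substitution returns 0 and the factor is 1, which leaves the left-hand side.\<close>

lemma higher_deriv_exp_substitution:
  fixes f :: "real \<Rightarrow> real"
  assumes f: "\<And>n. times_differentiable n f" and "k \<ge> 1"
  shows "t ^ k * (deriv ^^ k) f 0 =
    (\<Sum>j=1..k. of_int (stirling1_signed k j) * (deriv ^^ j) (\<lambda>w. f (t * (exp w - 1))) 0)"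
proof -
  define L where "L k w = exp w ^ k * t ^ k * (deriv ^^ k) f (t * (exp w - 1))" for k w
  have L: "(L k has_real_derivative of_nat k * L k x + L (Suc k) x) (at x)" for k x
  proof -
    have "((\<lambda>w. (deriv ^^ k) f (t * (exp w - 1))) has_real_derivative
        (deriv ^^ Suc k) f (t * (exp x - 1)) * (t * exp x)) (at x)"
      by (rule DERIV_chain2[OF higher_deriv_has_derivative[OF f]]) (auto intro!: derivative_eq_intros)
    moreover have "((\<lambda>w. exp w ^ k * t ^ k) has_real_derivative of_nat k * exp x ^ k * t ^ k) (at x)"
    proof -
      have "((\<lambda>w. exp (real k * w) * t ^ k) has_real_derivative real k * exp (real k * x) * t ^ k) (at x)"
        by (auto intro!: derivative_eq_intros)
      then show ?thesis by (simp only: exp_of_nat_mult)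
    qed
    ultimately have "((\<lambda>w. exp w ^ k * t ^ k * (deriv ^^ k) f (t * (exp w - 1))) has_real_derivative
       (of_nat k * exp x ^ k * t ^ k) * (deriv ^^ k) f (t * (exp x - 1)) +
       ((deriv ^^ Suc k) f (t * (exp x - 1)) * (t * exp x)) * (exp x ^ k * t ^ k)) (at x)"
      by (rule DERIV_mult[rotated])
    then show ?thesis by (simp add: L_def[abs_def] algebra_simps)
  qed
  have "L k 0 = (\<Sum>j\<le>k. of_int (stirling1_signed k j) * (deriv ^^ j) (L 0) 0)"
    by (rule stirling_inversion_deriv[OF L])
  also have "\<dots> = (\<Sum>j=1..k. of_int (stirling1_signed k j) * (deriv ^^ j) (L 0) 0)"
    using stirling1_signed_0_right[OF \<open>k \<ge> 1\<close>]
    by (intro sum.mono_neutral_right) (auto simp: not_le)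
  finally show ?thesis by (simp add: L_def[abs_def])
qed

section \<open>Absorbed cells\<close>

text \<open>A polytope is the hull of its extreme points; those of \<open>convex hull F\<close>
  belong to \<open>F\<close> and are not interior, so they lie in \<open>G\<close>.\<close>

lemma convex_hull_eq_if_noninterior_subset:
  fixes F :: "'a::euclidean_space set"
  assumes "finite F" "G \<subseteq> F" "F - interior (convex hull F) \<subseteq> G"
  shows "convex hull G = convex hull F"
proof
  show "convex hull G \<subseteq> convex hull F" using assms(2) by (rule hull_mono)
  have "{x. x extreme_point_of (convex hull F)} \<subseteq> G"
    using assms(3) extreme_point_not_in_interior extreme_point_of_convex_hull by blast
  then show "convex hull F \<subseteq> convex hull G"
    using Krein_Milman_polytope[OF assms(1)] hull_mono by metis
qed

text \<open>A point outside the perturbed hull is strictly separated from it. Pushed a further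
  \<open>\<delta>\<close> away it is still in the larger ball, yet outside
  \<open>convex hull F\<close>, since undoing the perturbation moves each vertex by at most
  \<open>\<delta>\<close>.\<close>

lemma ball_subset_convex_hull_perturbed:
  fixes F :: "'a::euclidean_space set"
  assumes "finite F" and sub: "cball p (2 * \<delta>) \<subseteq> convex hull F"
    and g: "\<And>f. f \<in> F \<Longrightarrow> dist (g f) f \<le> \<delta>" and "\<delta> > 0"
  shows "ball p \<delta> \<subseteq> convex hull (g ` F)"
proof
  fix q assume q: "q \<in> ball p \<delta>"
  show "q \<in> convex hull (g ` F)"
  proof (rule ccontr)
    assume "q \<notin> convex hull (g ` F)"
    moreover have "closed (convex hull (g ` F))"
      using assms(1) by (intro compact_imp_closed finite_imp_compact_convex_hull) auto
    ultimately obtain a b where ab: "inner a q < b" "\<And>x. x \<in> convex hull (g ` F) \<Longrightarrow> b < inner a x"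
      using separating_hyperplane_closed_point[of "convex hull (g ` F)" q] by auto
    have "a \<noteq> 0"
    proof
      assume "a = 0"
      have "F \<noteq> {}" using sub \<open>\<delta> > 0\<close> by auto
      then obtain f where "f \<in> F" by auto
      then have "b < inner a (g f)" by (intro ab hull_inc) auto
      then show False using ab(1) \<open>a = 0\<close> by simp
    qed
    \<comment> \<open>\<open>a\<close> points towards the perturbed hull, so \<open>r\<close> is on
      its far side. \<open>inner a r\<close> is below \<open>inner a q\<close> by
      \<open>\<delta> * norm a\<close>, the most that passing from \<open>g f\<close> to
      \<open>f\<close> can cost.\<close>
    define r where "r = q - (\<delta> / norm a) *\<^sub>R a"
    have "dist p r \<le> dist p q + dist q r" by (rule dist_triangle)
    also have "dist q r = \<delta>" using \<open>\<delta> > 0\<close> \<open>a \<noteq> 0\<close> by (simp add: r_def dist_norm)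
    finally have "r \<in> convex hull F" using q sub by auto
    moreover have "convex hull F \<subseteq> {x. inner a x > inner a r}"
    proof (rule hull_minimal)
      show "F \<subseteq> {x. inner a x > inner a r}"
      proof safe
        fix f assume "f \<in> F"
        have "inner a (g f - f) \<le> norm a * norm (g f - f)" by (rule norm_cauchy_schwarz)
        also have "\<dots> \<le> norm a * \<delta>" using g[OF \<open>f \<in> F\<close>] by (simp add: dist_norm mult_left_mono)
        finally have "inner a (g f) - inner a f \<le> norm a * \<delta>" by (simp add: inner_diff_right)
        moreover have "b < inner a (g f)" using \<open>f \<in> F\<close> by (intro ab hull_inc) auto
        moreover have "inner a r = inner a q - \<delta> * norm a"
          using \<open>a \<noteq> 0\<close> by (simp add: r_def inner_diff_right dot_square_norm power2_eq_square)
        ultimately show "inner a f > inner a r" using ab(1) by (simp add: mult.commute)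
      qed
    qed (rule convex_halfspace_gt)
    ultimately show False by auto
  qed
qed

text \<open>
  A code \<open>c\<close> cuts the space into cells \<open>c -` {i}\<close>, and \<open>J\<close> is the set of occupied cells. A cell,
  occupied or not, is absorbed if it lies inside the hull of any choice of one point from each
  of the other occupied cells.
\<close>

definition absorbed :: "('a::euclidean_space \<Rightarrow> nat) \<Rightarrow> nat set \<Rightarrow> nat set" where
  "absorbed c J = {i \<in> range c. \<forall>x. (\<forall>j\<in>J - {i}. c (x j) = j) \<longrightarrow>
     c -` {i} \<subseteq> interior (convex hull (x ` (J - {i})))}"

lemma absorbedD:
  assumes "c p \<in> absorbed c J" "\<And>j. j \<in> J \<Longrightarrow> j \<noteq> c p \<Longrightarrow> c (x j) = j"
  shows "p \<in> interior (convex hull (x ` (J - {c p})))"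
proof -
  have "c -` {c p} \<subseteq> interior (convex hull (x ` (J - {c p})))"
    using assms by (auto simp: absorbed_def)
  then show ?thesis by auto
qed

lemma absorbedI:
  assumes "i \<in> range c"
    "\<And>x p. (\<And>j. j \<in> J \<Longrightarrow> j \<noteq> i \<Longrightarrow> c (x j) = j) \<Longrightarrow> c p = i \<Longrightarrow>
       p \<in> interior (convex hull (x ` (J - {i})))"
  shows "i \<in> absorbed c J"
  using assms by (auto simp: absorbed_def)

lemma absorbed_subset_range: "absorbed c J \<subseteq> range c"
  by (auto simp: absorbed_def)

text \<open>A choice of points for \<open>J'\<close> is also one for \<open>J\<close>, and the hull
  over \<open>J\<close> is the smaller one.\<close>

lemma absorbed_mono: "J \<subseteq> J' \<Longrightarrow> absorbed c J \<subseteq> absorbed c J'"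
proof
  fix i assume J: "J \<subseteq> J'" and i: "i \<in> absorbed c J"
  show "i \<in> absorbed c J'"
  proof (rule absorbedI)
    fix x p assume x: "\<And>j. j \<in> J' \<Longrightarrow> j \<noteq> i \<Longrightarrow> c (x j) = j" and p: "c p = i"
    have "p \<in> interior (convex hull (x ` (J - {c p})))" using i p x J by (intro absorbedD) auto
    also have "\<dots> \<subseteq> interior (convex hull (x ` (J' - {c p})))"
      using J by (intro interior_mono hull_mono) auto
    finally show "p \<in> interior (convex hull (x ` (J' - {i})))" using p by simp
  qed (use i absorbed_subset_range in blast)
qed

text \<open>The condition on \<open>i\<close> involves only \<open>J - {i}\<close>: a cell does not
  contribute to its own absorption.\<close>

lemma mem_absorbed_insert: "i \<in> absorbed c (insert i J) \<longleftrightarrow> i \<in> absorbed c J"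
  by (simp add: absorbed_def)

text \<open>Suppose cell \<open>k\<close> is absorbed once \<open>i\<close> is occupied. For
  \<open>p\<close> in cell \<open>k\<close> and \<open>y\<close> in cell \<open>i\<close>, both
  points are interior to the hull of the remaining points together with \<open>p\<close> and
  \<open>y\<close>. Deleting both leaves the hull unchanged, so \<open>k\<close> was absorbed
  without \<open>i\<close>.\<close>

lemma absorbed_insert:
  fixes c :: "'a::euclidean_space \<Rightarrow> nat"
  assumes fin: "finite J" and i: "i \<in> absorbed c J" "i \<notin> J"
  shows "absorbed c (insert i J) = absorbed c J"
proof
  show "absorbed c J \<subseteq> absorbed c (insert i J)" by (rule absorbed_mono) auto
  show "absorbed c (insert i J) \<subseteq> absorbed c J"
  proof
    fix k assume k: "k \<in> absorbed c (insert i J)"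
    show "k \<in> absorbed c J"
    proof (cases "k = i")
      case False
      have "p \<in> interior (convex hull (x ` (J - {k})))"
        if x: "\<forall>j\<in>J - {k}. c (x j) = j" and p: "c p = k" for x p
      proof -
        define S where "S = x ` (J - {k})"
        obtain y where y: "c y = i" using i by (auto simp: absorbed_def)
        \<comment> \<open>If \<open>k\<close> is occupied, \<open>p\<close> represents it here;
          otherwise the update has no effect. Either way at most \<open>p\<close> is added to
          \<open>S\<close>.\<close>
        have "y \<in> interior (convex hull ((x(k := p)) ` (J - {c y})))"
          using i(1) x p y by (intro absorbedD) auto
        also have "\<dots> \<subseteq> interior (convex hull (insert p (insert y S)))"
          by (intro interior_mono hull_mono) (auto simp: S_def)
        finally have y': "y \<in> interior (convex hull (insert p (insert y S)))" .
        have "(x(i := y)) ` (insert i J - {k}) = insert y S"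
          using i(2) False by (auto simp: S_def image_def split: if_splits)
        moreover have "p \<in> interior (convex hull ((x(i := y)) ` (insert i J - {c p})))"
          using k x p y by (intro absorbedD) auto
        ultimately have "p \<in> interior (convex hull (insert y S))" using p by simp
        also have "\<dots> \<subseteq> interior (convex hull (insert p (insert y S)))"
          by (intro interior_mono hull_mono) auto
        finally have p': "p \<in> interior (convex hull (insert p (insert y S)))" .
        have "convex hull S = convex hull (insert p (insert y S))"
          using fin y' p' by (intro convex_hull_eq_if_noninterior_subset) (auto simp: S_def)
        then show ?thesis using p' by (simp add: S_def)
      qed
      then show ?thesis using k absorbed_subset_range[of c "insert i J"]
        by (intro absorbedI) auto
    qed (use i in simp)
  qed
qed

text \<open>\<open>absorbed_insert\<close> applies to \<open>J - {i}\<close>, by which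
  \<open>i\<close> is still absorbed. Monotonicity then squeezes \<open>absorbed c J\<close> between
  two equal sets.\<close>

lemma absorbed_toggle:
  assumes "finite J" "i \<in> absorbed c J"
  shows "absorbed c (insert i J) = absorbed c J" "absorbed c (J - {i}) = absorbed c J"
proof -
  have "i \<in> absorbed c (J - {i})"
    using assms(2) mem_absorbed_insert[of i c "J - {i}"] mem_absorbed_insert[of i c J] by simp
  then have *: "absorbed c (insert i J) = absorbed c (J - {i})"
    using absorbed_insert[of "J - {i}" i c] assms(1) by simp
  show "absorbed c (J - {i}) = absorbed c J" "absorbed c (insert i J) = absorbed c J"
    using * absorbed_mono[of "J - {i}" J c] absorbed_mono[of J "insert i J" c] by auto
qed

text \<open>One point of \<open>F\<close> from each occupied cell is an admissible choice, and its
  hull lies in that of \<open>F\<close>.\<close>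

lemma absorbed_imp_interior:
  fixes F :: "'a::euclidean_space set"
  assumes "c p \<in> absorbed c (c ` F)"
  shows "p \<in> interior (convex hull F)"
proof -
  define x where "x j = (SOME f. f \<in> F \<and> c f = j)" for j
  have x: "x j \<in> F \<and> c (x j) = j" if "j \<in> c ` F" for j
    unfolding x_def by (rule someI_ex) (use that in auto)
  then have "p \<in> interior (convex hull (x ` (c ` F - {c p})))"
    using assms by (intro absorbedD) auto
  also have "\<dots> \<subseteq> interior (convex hull F)" using x by (intro interior_mono hull_mono) auto
  finally show ?thesis .
qed

text \<open>Cells are required to be small only where they meet the ball of radius \<open>r\<close>,
  so that finitely many can cover the whole space.\<close>

definition fine_code :: "real \<Rightarrow> ('a::euclidean_space \<Rightarrow> nat) \<Rightarrow> bool" where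
  "fine_code r c \<longleftrightarrow> c \<in> borel \<rightarrow>\<^sub>M count_space UNIV \<and> finite (range c) \<and>
     (\<forall>x\<in>cball 0 r. \<forall>y. c x = c y \<longrightarrow> dist x y < 1 / r)"

lemma fine_code_exists:
  assumes "r > 0"
  shows "\<exists>c :: 'a::euclidean_space \<Rightarrow> nat. fine_code r c"
proof -
  define e where "e = 1 / (2 * r)"
  have "e > 0" using assms by (simp add: e_def)
  then obtain k where k: "finite k" "cball (0::'a) r \<subseteq> (\<Union>x\<in>k. ball x e)"
    using compact_imp_seq_compact[OF compact_cball[of "0::'a" r]] seq_compact_imp_totally_bounded
    by metis
  then obtain xs where xs: "set xs = k" using finite_list by auto
  \<comment> \<open>A point gets the index of the first covering ball that contains it. The disjunct
    \<open>length xs \<le> n\<close> gives \<open>LEAST\<close> a value outside all balls; these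
    points form one leftover cell.\<close>
  define P where "P x n \<longleftrightarrow> length xs \<le> n \<or> dist (xs ! n) x < e" for x n
  define c where "c x = (LEAST n. P x n)" for x
  have le: "c x \<le> length xs" for x unfolding c_def by (rule Least_le) (simp add: P_def)
  have P: "P x (c x)" for x unfolding c_def by (rule LeastI[of _ "length xs"]) (simp add: P_def)
  have [measurable]: "c \<in> borel \<rightarrow>\<^sub>M count_space UNIV"
    unfolding c_def P_def by measurable
  have "range c \<subseteq> {..length xs}" using le by auto
  then have "finite (range c)" by (rule finite_subset) simp
  moreover have "dist x y < 1 / r" if x: "x \<in> cball 0 r" and eq: "c x = c y" for x y
  proof -
    obtain z where "z \<in> set xs" "dist z x < e" using x k xs by auto
    then obtain n where n: "n < length xs" "dist (xs ! n) x < e" by (auto simp: in_set_conv_nth)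
    then have "c x \<le> n" unfolding c_def by (intro Least_le) (simp add: P_def)
    then have "dist (xs ! c x) x < e" "dist (xs ! c x) y < e"
      using n P[of x] P[of y] eq by (auto simp: P_def)
    then have "dist x y < e + e" by (metis add_strict_mono dist_triangle3 le_less_trans)
    also have "e + e = 1 / r" using assms by (simp add: e_def field_simps)
    finally show ?thesis .
  qed
  ultimately show ?thesis unfolding fine_code_def by (intro exI[of _ c]) auto
qed

text \<open>Absorbed points are interior for every \<open>m\<close>. Conversely, a ball around an
  interior \<open>p\<close> stays in the hull after \<open>p\<close> is deleted from
  \<open>F\<close> and the other points are moved slightly within their cells.\<close>

lemma eventually_absorbed_iff_interior:
  fixes F :: "'a::euclidean_space set" and c :: "nat \<Rightarrow> 'a \<Rightarrow> nat"
  assumes fin: "finite F" and c: "\<And>m. fine_code (Suc m) (c m)"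
  shows "eventually (\<lambda>m. c m p \<in> absorbed (c m) (c m ` F) \<longleftrightarrow> p \<in> interior (convex hull F)) sequentially"
proof (cases "p \<in> interior (convex hull F)")
  case False
  then show ?thesis using absorbed_imp_interior by (intro always_eventually) blast
next
  case True
  define G where "G = F - {p}"
  have "finite G" using fin by (simp add: G_def)
  \<comment> \<open>Deleting \<open>p\<close> keeps the hull and leaves \<open>G\<close> at positive
    distance from \<open>p\<close>, so that eventually no point of \<open>G\<close> shares its
    cell.\<close>
  have "convex hull G = convex hull F"
    using True fin by (intro convex_hull_eq_if_noninterior_subset) (auto simp: G_def)
  then obtain e where e: "e > 0" "cball p e \<subseteq> convex hull G"
    using True mem_interior_cball by metis
  define \<delta> where "\<delta> = e / 2"
  have \<delta>: "\<delta> > 0" "cball p (2 * \<delta>) \<subseteq> convex hull G" using e by (auto simp: \<delta>_def)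
  have inv: "(\<lambda>m. 1 / real (Suc m)) \<longlonglongrightarrow> 0"
    using LIMSEQ_inverse_real_of_nat by (simp add: inverse_eq_divide)
  have small: "eventually (\<lambda>m. 1 / real (Suc m) < r) sequentially" if "r > 0" for r :: real
    using order_tendstoD(2)[OF inv that] .
  have large: "eventually (\<lambda>m. q \<in> cball (0::'a) (real (Suc m))) sequentially" for q
  proof -
    have "eventually (\<lambda>m. norm q \<le> real m) sequentially" by real_asymp
    then show ?thesis by eventually_elim auto
  qed
  have "eventually (\<lambda>m. \<forall>f\<in>G. f \<in> cball 0 (real (Suc m))) sequentially"
    using \<open>finite G\<close> large by (intro eventually_ball_finite) auto
  moreover have "eventually (\<lambda>m. \<forall>f\<in>G. 1 / real (Suc m) < dist p f) sequentially"
    using \<open>finite G\<close> by (intro eventually_ball_finite ballI small) (auto simp: G_def)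
  ultimately show ?thesis using small[OF \<delta>(1)] large[of p]
  proof eventually_elim
    case (elim m)
    have near: "dist x y < 1 / real (Suc m)" if "x \<in> cball 0 (real (Suc m))" "c m x = c m y" for x y
      using c[of m] that unfolding fine_code_def by blast
    have "c m f \<noteq> c m p" if "f \<in> G" for f
      using near[of p f] elim that by force
    then have J: "c m ` F - {c m p} = c m ` G" by (auto simp: G_def)
    have "c m -` {c m p} \<subseteq> interior (convex hull (x ` c m ` G))"
      if x: "\<forall>j\<in>c m ` G. c m (x j) = j" for x
    proof -
      \<comment> \<open>Replacing each \<open>f\<close> by the chosen point of its cell is a
        perturbation of size at most \<open>\<delta>\<close>.\<close>
      have "dist ((x \<circ> c m) f) f \<le> \<delta>" if "f \<in> G" for f
        using near[of f "x (c m f)"] x elim that by (force simp: dist_commute)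
      then have "ball p \<delta> \<subseteq> convex hull ((x \<circ> c m) ` G)"
        using \<open>finite G\<close> \<delta> by (intro ball_subset_convex_hull_perturbed) auto
      then have "ball p \<delta> \<subseteq> interior (convex hull (x ` c m ` G))"
        by (intro interior_maximal) (auto simp: image_comp)
      \<comment> \<open>Absorption concerns the whole cell of \<open>p\<close>, which by now fits
        into the ball.\<close>
      moreover have "c m -` {c m p} \<subseteq> ball p \<delta>"
        using less_trans[OF near[of p] elim(3)] elim(4) by auto
      ultimately show ?thesis by blast
    qed
    then show ?case using True J by (auto simp: absorbed_def)
  qed
qed

section \<open>Independent Poisson counts\<close>

text \<open>Elements of \<open>S\<close> go one at a time; \<open>cl\<close> stays the same, so the
  rest of \<open>S\<close> still lies in it.\<close>

lemma toggle_invariant_Diff: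
  assumes tog: "\<And>J i. J \<subseteq> C \<Longrightarrow> i \<in> cl J \<Longrightarrow> cl (J - {i}) = cl J"
    and "J \<subseteq> C" "finite S" "S \<subseteq> cl J"
  shows "cl (J - S) = cl J"
  using assms(3,4)
proof (induction S)
  case (insert i S)
  then have "cl (J - S - {i}) = cl (J - S)" using assms(2) by (intro tog) auto
  moreover have "J - S - {i} = J - insert i S" by auto
  ultimately show ?case using insert by simp
qed simp

lemma toggle_invariant_Un:
  assumes tog: "\<And>J i. J \<subseteq> C \<Longrightarrow> i \<in> cl J \<Longrightarrow> cl (insert i J) = cl J"
    and "J \<subseteq> C" "finite S" "S \<subseteq> cl J" "cl J \<subseteq> C"
  shows "cl (J \<union> S) = cl J"
  using assms(3,4)
proof (induction S)
  case (insert i S)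
  then have "cl (insert i (J \<union> S)) = cl (J \<union> S)" using assms(2,5) by (intro tog) auto
  then show ?case using insert by simp
qed simp

text \<open>
  Given the counts \<open>n\<close>, only the summand \<open>U = J - cl J\<close> survives: invariance under toggling says
  that \<open>cl J\<close> is determined by the occupied cells outside it. This makes each summand a product
  of functions of single counts, to which independence applies.
\<close>

lemma sum_prod_toggle_invariant:
  fixes a :: "'i \<Rightarrow> real" and n :: "'i \<Rightarrow> nat"
  assumes C: "finite C" "\<And>J. cl J \<subseteq> C"
    and tog: "\<And>J i. J \<subseteq> C \<Longrightarrow> i \<in> cl J \<Longrightarrow> cl (insert i J) = cl J"
             "\<And>J i. J \<subseteq> C \<Longrightarrow> i \<in> cl J \<Longrightarrow> cl (J - {i}) = cl J"
  defines "J \<equiv> {i \<in> C. n i > 0}"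
  shows "(\<Sum>U | U \<subseteq> C \<and> U \<inter> cl U = {}. \<Prod>i\<in>C.
            if i \<in> cl U then a i else if i \<in> U then of_bool (n i > 0) else of_bool (n i = 0))
          = (\<Prod>i\<in>cl J. a i)" (is "(\<Sum>U\<in>?Q. ?f U) = _")
proof -
  have J: "J \<subseteq> C" by (auto simp: J_def)
  have fin: "finite (cl U)" for U using C finite_subset by blast
  define U0 where "U0 = J - cl J"
  have U0: "cl U0 = cl J"
    unfolding U0_def by (rule toggle_invariant_Diff[OF tog(2) J fin]) auto
  have "?f U = 0" if "U \<in> ?Q - {U0}" for U
  proof (rule ccontr)
    assume "?f U \<noteq> 0"
    \<comment> \<open>No factor of a nonzero product is zero, so \<open>U\<close> and
      \<open>J\<close> agree outside \<open>cl U\<close>.\<close>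
    then have *: "i \<in> U \<longleftrightarrow> n i > 0" if "i \<in> C" "i \<notin> cl U" for i
      using C(1) that by (auto split: if_splits)
    \<comment> \<open>\<open>J\<close> arises from \<open>U\<close> by adding elements of
      \<open>cl U\<close>; invariance gives \<open>cl J = cl U\<close>, and then
      \<open>U = J - cl J\<close>.\<close>
    have "J = U \<union> (J \<inter> cl U)" using * that J by (auto simp: J_def)
    moreover have "cl (U \<union> (J \<inter> cl U)) = cl U"
      using that C fin by (intro toggle_invariant_Un[OF tog(1)]) auto
    ultimately have "cl J = cl U" by simp
    then have "U = U0" using * that J by (auto simp: U0_def J_def)
    then show False using that by simp
  qed
  moreover have "U0 \<in> ?Q" using U0 J by (auto simp: U0_def)
  ultimately have "(\<Sum>U\<in>?Q. ?f U) = ?f U0"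
    using C(1) by (subst sum.mono_neutral_right[of ?Q "{U0}"]) auto
  also have "\<dots> = (\<Prod>i\<in>C. if i \<in> cl J then a i else 1)"
    using U0 by (intro prod.cong) (auto simp: U0_def J_def)
  also have "\<dots> = (\<Prod>i\<in>cl J. a i)"
    using C by (simp add: prod.If_cases Int_absorb1)
  finally show ?thesis .
qed

section \<open>Exponential moments\<close>

context prob_space
begin

text \<open>The nonnegative integral yields value and integrability together. Splitting by the value
  of \<open>N\<close> leaves the exponential series of \<open>p * exp w\<close>.\<close>

lemma poisson_exponential_moment:
  fixes N :: "'a \<Rightarrow> nat"
  assumes [measurable]: "N \<in> M \<rightarrow>\<^sub>M count_space UNIV" and "p \<ge> 0"
    and P: "\<And>n. prob {\<omega> \<in> space M. N \<omega> = n} = exp (- p) * p ^ n / fact n"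
  shows "has_bochner_integral M (\<lambda>\<omega>. exp (w * real (N \<omega>))) (exp (p * (exp w - 1)))"
proof (rule has_bochner_integral_nn_integral)
  have "(\<integral>\<^sup>+\<omega>. ennreal (exp (w * real (N \<omega>))) \<partial>M) =
      (\<integral>\<^sup>+\<omega>. (\<Sum>n. ennreal (exp (w * real n)) * indicator {\<omega> \<in> space M. N \<omega> = n} \<omega>) \<partial>M)"
  proof (rule nn_integral_cong)
    fix \<omega> assume "\<omega> \<in> space M"
    then show "ennreal (exp (w * real (N \<omega>))) =
        (\<Sum>n. ennreal (exp (w * real n)) * indicator {\<omega> \<in> space M. N \<omega> = n} \<omega>)"
      by (subst suminf_finite[of "{N \<omega>}"]) (auto simp: indicator_def)
  qed
  also have "\<dots> = (\<Sum>n. ennreal (exp (w * real n)) * emeasure M {\<omega> \<in> space M. N \<omega> = n})"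
    by (subst nn_integral_suminf) (auto simp: nn_integral_cmult_indicator)
  also have "\<dots> = (\<Sum>n. ennreal (exp (w * real n) * (exp (- p) * p ^ n / fact n)))"
    by (simp add: emeasure_eq_measure P ennreal_mult'[symmetric] \<open>p \<ge> 0\<close>)
  also have "\<dots> = ennreal (exp (p * (exp w - 1)))"
  proof (rule suminf_ennreal_eq)
    have "(\<lambda>n. exp (- p) * ((p * exp w) ^ n /\<^sub>R fact n)) sums (exp (- p) * exp (p * exp w))"
      by (intro sums_mult exp_converges)
    moreover have "exp (- p) * exp (p * exp w) = exp (p * (exp w - 1))"
      by (simp add: exp_add[symmetric] algebra_simps)
    moreover have "exp (- p) * ((p * exp w) ^ n /\<^sub>R fact n) = exp (w * real n) * (exp (- p) * p ^ n / fact n)" for n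
      by (simp add: power_mult_distrib exp_of_nat2_mult field_simps)
    ultimately show "(\<lambda>n. exp (w * real n) * (exp (- p) * p ^ n / fact n)) sums exp (p * (exp w - 1))"
      by simp
  qed (use \<open>p \<ge> 0\<close> in auto)
  finally show "(\<integral>\<^sup>+\<omega>. ennreal (exp (w * real (N \<omega>))) \<partial>M) = ennreal (exp (p * (exp w - 1)))" .
qed auto

text \<open>Both exponentials expand into sums of products of functions of single counts.
  Corresponding products differ only at \<open>i\<close> in \<open>cl U\<close>, where one side has
  a random factor and the other its mean. By independence it suffices to compare single
  factors.\<close>

lemma poisson_toggle_invariant_mgf:
  fixes N :: "'i \<Rightarrow> 'a \<Rightarrow> nat" and p :: "'i \<Rightarrow> real"
  assumes indep: "indep_vars (\<lambda>_. count_space UNIV) N C" and p: "\<And>i. i \<in> C \<Longrightarrow> p i \<ge> 0"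
    and P: "\<And>i n. i \<in> C \<Longrightarrow> prob {\<omega> \<in> space M. N i \<omega> = n} = exp (- p i) * p i ^ n / fact n"
    and C: "finite C" "\<And>J. cl J \<subseteq> C"
    and tog: "\<And>J i. J \<subseteq> C \<Longrightarrow> i \<in> cl J \<Longrightarrow> cl (insert i J) = cl J"
             "\<And>J i. J \<subseteq> C \<Longrightarrow> i \<in> cl J \<Longrightarrow> cl (J - {i}) = cl J"
  shows "expectation (\<lambda>\<omega>. exp (w * (\<Sum>i\<in>cl {i \<in> C. N i \<omega> > 0}. real (N i \<omega>)))) =
         expectation (\<lambda>\<omega>. exp ((exp w - 1) * (\<Sum>i\<in>cl {i \<in> C. N i \<omega> > 0}. p i)))"
proof -
  let ?Q = "{U. U \<subseteq> C \<and> U \<inter> cl U = {}}"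
  define g where "g a U i n = (if i \<in> cl U then a i n else if i \<in> U then of_bool (n > 0) else of_bool (n = 0))"
    for a :: "'i \<Rightarrow> nat \<Rightarrow> real" and U i and n :: nat
  \<comment> \<open>\<open>b i\<close> is the mean of \<open>a i (N i \<omega>)\<close>; its dummy
    argument lets \<open>g\<close> serve both sides.\<close>
  define a where "a i n = exp (w * real n)" for i :: 'i and n :: nat
  define b where "b i n = exp (p i * (exp w - 1))" for i :: 'i and n :: nat
  have N[measurable]: "N i \<in> M \<rightarrow>\<^sub>M count_space UNIV" if "i \<in> C" for i
    using indep that by (auto simp: indep_vars_def)
  have mom: "has_bochner_integral M (\<lambda>\<omega>. a i (N i \<omega>)) (exp (p i * (exp w - 1)))" if "i \<in> C" for i
    unfolding a_def using that p P N by (intro poisson_exponential_moment) auto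
  have bnd: "integrable M (\<lambda>\<omega>. of_bool (Q (N i \<omega>)) :: real)" if "i \<in> C" for i Q
    using N[OF that] by (intro integrable_const_bound[of _ 1]) (auto intro!: measurable_compose[OF N[OF that]])
  have ga: "integrable M (\<lambda>\<omega>. g a U i (N i \<omega>))" if "i \<in> C" for U i
    using mom[OF that] bnd[OF that, of "\<lambda>n. n > 0"] bnd[OF that, of "\<lambda>n. n = 0"] unfolding g_def
    by (cases "i \<in> cl U"; cases "i \<in> U") (auto simp: has_bochner_integral_iff)
  have gb: "integrable M (\<lambda>\<omega>. g b U i (N i \<omega>))" if "i \<in> C" for U i
    using bnd[OF that, of "\<lambda>n. n > 0"] bnd[OF that, of "\<lambda>n. n = 0"] unfolding g_def b_def
    by (cases "i \<in> cl U"; cases "i \<in> U") auto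
  have gab: "expectation (\<lambda>\<omega>. g a U i (N i \<omega>)) = expectation (\<lambda>\<omega>. g b U i (N i \<omega>))" if "i \<in> C" for U i
    using mom[OF that]
    by (cases "i \<in> cl U"; cases "i \<in> U") (auto simp: g_def b_def has_bochner_integral_iff prob_space)
  have ind: "indep_vars (\<lambda>_. borel) (\<lambda>i \<omega>. g f U i (N i \<omega>)) C" for f U
    by (rule indep_vars_compose2[OF indep]) auto
  have ea: "exp (w * (\<Sum>i\<in>cl {i \<in> C. N i \<omega> > 0}. real (N i \<omega>))) = (\<Sum>U\<in>?Q. \<Prod>i\<in>C. g a U i (N i \<omega>))" for \<omega>
    unfolding g_def
    by (subst sum_prod_toggle_invariant[OF C tog, where n = "\<lambda>i. N i \<omega>"])
      (use C in \<open>auto simp: a_def sum_distrib_left intro: exp_sum finite_subset\<close>)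
  have eb: "exp ((exp w - 1) * (\<Sum>i\<in>cl {i \<in> C. N i \<omega> > 0}. p i)) = (\<Sum>U\<in>?Q. \<Prod>i\<in>C. g b U i (N i \<omega>))" for \<omega>
    unfolding g_def
    by (subst sum_prod_toggle_invariant[OF C tog, where n = "\<lambda>i. N i \<omega>"])
      (use C in \<open>auto simp: b_def sum_distrib_left mult.commute intro: exp_sum finite_subset\<close>)
  have "expectation (\<lambda>\<omega>. \<Sum>U\<in>?Q. \<Prod>i\<in>C. g a U i (N i \<omega>)) = (\<Sum>U\<in>?Q. \<Prod>i\<in>C. expectation (\<lambda>\<omega>. g a U i (N i \<omega>)))"
    using indep_vars_integrable[OF C(1) ind ga] indep_vars_lebesgue_integral[OF C(1) ind ga]
    by (subst Bochner_Integration.integral_sum) auto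
  also have "\<dots> = (\<Sum>U\<in>?Q. \<Prod>i\<in>C. expectation (\<lambda>\<omega>. g b U i (N i \<omega>)))" using gab by simp
  also have "\<dots> = expectation (\<lambda>\<omega>. \<Sum>U\<in>?Q. \<Prod>i\<in>C. g b U i (N i \<omega>))"
    using indep_vars_integrable[OF C(1) ind gb] indep_vars_lebesgue_integral[OF C(1) ind gb]
    by (subst Bochner_Integration.integral_sum) auto
  finally show ?thesis unfolding ea eb .
qed

text \<open>The moments of \<open>V\<close> lie in the unit interval, so the exponential series may
  be integrated termwise, dominated by that of \<open>\<bar>z\<bar>\<close>. The result is a power
  series converging everywhere.\<close>

lemma times_differentiable_mgf:
  assumes [measurable]: "V \<in> borel_measurable M" and V: "\<And>\<omega>. \<omega> \<in> space M \<Longrightarrow> 0 \<le> V \<omega> \<and> V \<omega> \<le> (1::real)"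
  shows "times_differentiable m (\<lambda>z. expectation (\<lambda>\<omega>. exp (z * V \<omega>)))"
proof -
  define c where "c n = expectation (\<lambda>\<omega>. V \<omega> ^ n) / fact n" for n
  have int: "integrable M (\<lambda>\<omega>. V \<omega> ^ n)" for n
    using V by (intro integrable_const_bound[of _ 1]) (auto intro!: AE_I2 power_le_one)
  have "(\<lambda>n. c n * z ^ n) sums expectation (\<lambda>\<omega>. exp (z * V \<omega>))" for z
  proof -
    have i: "integrable M (\<lambda>\<omega>. (z * V \<omega>) ^ n /\<^sub>R fact n)" for n
      using int[of n] by (auto simp: power_mult_distrib)
    have nrm: "norm ((z * V \<omega>) ^ n /\<^sub>R fact n) \<le> \<bar>z\<bar> ^ n /\<^sub>R fact n" if "\<omega> \<in> space M" for \<omega> n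
      using V[OF that] by (auto simp: abs_mult power_abs intro!: divide_right_mono power_mono mult_left_le)
    have s: "summable (\<lambda>n. \<bar>z\<bar> ^ n /\<^sub>R fact n)" by (rule summable_exp_generic)
    have "(\<lambda>n. expectation (\<lambda>\<omega>. (z * V \<omega>) ^ n /\<^sub>R fact n)) sums expectation (\<lambda>\<omega>. \<Sum>n. (z * V \<omega>) ^ n /\<^sub>R fact n)"
    proof (rule sums_integral[OF i])
      show "AE \<omega> in M. summable (\<lambda>n. norm ((z * V \<omega>) ^ n /\<^sub>R fact n))"
        by (rule AE_I2) (rule summable_norm_exp)
      have "expectation (\<lambda>\<omega>. norm ((z * V \<omega>) ^ n /\<^sub>R fact n)) \<le> \<bar>z\<bar> ^ n /\<^sub>R fact n" for n
        using integral_mono[of M "\<lambda>\<omega>. norm ((z * V \<omega>) ^ n /\<^sub>R fact n)" "\<lambda>_. \<bar>z\<bar> ^ n /\<^sub>R fact n"] i[of n] nrm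
        by (auto simp: prob_space)
      then show "summable (\<lambda>n. expectation (\<lambda>\<omega>. norm ((z * V \<omega>) ^ n /\<^sub>R fact n)))"
        by (intro summable_comparison_test'[OF s, of 0]) auto
    qed
    moreover have "expectation (\<lambda>\<omega>. (z * V \<omega>) ^ n /\<^sub>R fact n) = c n * z ^ n" for n
      by (simp add: c_def power_mult_distrib field_simps)
    ultimately show ?thesis by (simp add: exp_def)
  qed
  then have "summable (\<lambda>n. c n * z ^ n)" "expectation (\<lambda>\<omega>. exp (z * V \<omega>)) = (\<Sum>n. c n * z ^ n)" for z
    by (auto simp: sums_iff)
  then show ?thesis using times_differentiable_powser by simp
qed

end

section \<open>The Poisson hull\<close>

locale poisson_process = prob_space M for M :: "'w measure" +
  fixes \<mu> :: "'a::euclidean_space measure" and t :: real and \<eta> :: "'w \<Rightarrow> 'a set"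
  assumes prob_\<mu>: "prob_space \<mu>" and sets_\<mu>[measurable_cong, simp]: "sets \<mu> = sets borel"
    and ac: "absolutely_continuous lborel \<mu>" and t_pos: "t > 0"
    and ppp: "poisson_point_process M \<mu> t \<eta>"
begin

interpretation \<mu>: prob_space \<mu> by (rule prob_\<mu>)

lemma space_\<mu>[simp]: "space \<mu> = UNIV"
  using sets_eq_imp_space_eq[OF sets_\<mu>] by simp

lemma finite_\<eta>: "\<omega> \<in> space M \<Longrightarrow> finite (\<eta> \<omega>)"
  using ppp by (simp add: poisson_point_process_def)

lemma measurable_count: "A \<in> sets borel \<Longrightarrow> (\<lambda>\<omega>. card (\<eta> \<omega> \<inter> A)) \<in> M \<rightarrow>\<^sub>M count_space UNIV"
  using ppp by (simp add: poisson_point_process_def)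

lemma prob_count:
  "A \<in> sets borel \<Longrightarrow> prob {\<omega> \<in> space M. card (\<eta> \<omega> \<inter> A) = n} =
    exp (- (t * measure \<mu> A)) * (t * measure \<mu> A) ^ n / fact n"
  using ppp by (simp add: poisson_point_process_def)

lemma indep_count:
  fixes I :: "nat set"
  assumes "finite I" "disjoint_family_on A I" "\<And>i. i \<in> I \<Longrightarrow> A i \<in> sets borel"
  shows "indep_vars (\<lambda>_. count_space UNIV) (\<lambda>i \<omega>. card (\<eta> \<omega> \<inter> A i)) I"
  using ppp assms by (simp add: poisson_point_process_def)

text \<open>The discretised interior of the hull: a union of cells that depends on the process only
  through which cells are occupied.\<close>

definition absorbed_points :: "('a \<Rightarrow> nat) \<Rightarrow> 'w \<Rightarrow> 'a set" where
  "absorbed_points c \<omega> = {p. c p \<in> absorbed c (c ` \<eta> \<omega>)}"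

context
  fixes c :: "'a \<Rightarrow> nat"
  assumes c[measurable]: "c \<in> borel \<rightarrow>\<^sub>M count_space UNIV" and fin_c: "finite (range c)"
begin

lemma sets_code_vimage[measurable]: "c -` B \<in> sets borel"
  using measurable_sets[OF c, of B] by simp

lemma image_code_eq: "\<omega> \<in> space M \<Longrightarrow> c ` \<eta> \<omega> = {i \<in> range c. card (\<eta> \<omega> \<inter> c -` {i}) > 0}"
  using finite_\<eta>[of \<omega>] by (auto simp: card_gt_0_iff disjoint_iff intro: rev_image_eqI)

text \<open>The target is finite and discrete. Preimages of singletons are conditions on finitely
  many counts, and every function of the occupied cells becomes measurable.\<close>

lemma measurable_image_code: "(\<lambda>\<omega>. c ` \<eta> \<omega>) \<in> M \<rightarrow>\<^sub>M count_space (Pow (range c))"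
proof -
  have [measurable]: "(\<lambda>\<omega>. card (\<eta> \<omega> \<inter> c -` {i})) \<in> M \<rightarrow>\<^sub>M count_space UNIV" for i
    by (intro measurable_count sets_code_vimage)
  have "(\<lambda>\<omega>. c ` \<eta> \<omega>) -` {U} \<inter> space M \<in> sets M" if "U \<subseteq> range c" for U
  proof -
    have "(\<lambda>\<omega>. c ` \<eta> \<omega>) -` {U} \<inter> space M =
        {\<omega> \<in> space M. \<forall>i\<in>range c. card (\<eta> \<omega> \<inter> c -` {i}) > 0 \<longleftrightarrow> i \<in> U}"
    proof -
      have "c ` \<eta> \<omega> = U \<longleftrightarrow> (\<forall>i\<in>range c. card (\<eta> \<omega> \<inter> c -` {i}) > 0 \<longleftrightarrow> i \<in> U)"
        if "\<omega> \<in> space M" for \<omega>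
        unfolding image_code_eq[OF that] using \<open>U \<subseteq> range c\<close> by blast
      then show ?thesis by blast
    qed
    also have "\<dots> \<in> sets M" using fin_c by measurable
    finally show ?thesis .
  qed
  then show ?thesis using fin_c by (subst measurable_count_space_eq2) auto
qed

lemma measurable_fun_image_code: "(\<lambda>\<omega>. f (c ` \<eta> \<omega>)) \<in> borel_measurable M"
  by (rule measurable_compose[OF measurable_image_code]) simp

lemma card_absorbed_points:
  assumes "\<omega> \<in> space M"
  shows "card (\<eta> \<omega> \<inter> absorbed_points c \<omega>) = (\<Sum>i\<in>absorbed c (c ` \<eta> \<omega>). card (\<eta> \<omega> \<inter> c -` {i}))"
proof -
  have "\<eta> \<omega> \<inter> absorbed_points c \<omega> = (\<Union>i\<in>absorbed c (c ` \<eta> \<omega>). \<eta> \<omega> \<inter> c -` {i})"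
    by (auto simp: absorbed_points_def)
  then show ?thesis
    using finite_\<eta>[OF assms] finite_subset[OF absorbed_subset_range fin_c]
    by (simp only:) (subst card_UN_disjoint, auto)
qed

lemma measure_absorbed_points:
  "measure \<mu> (absorbed_points c \<omega>) = (\<Sum>i\<in>absorbed c (c ` \<eta> \<omega>). measure \<mu> (c -` {i}))"
proof -
  have "absorbed_points c \<omega> = (\<Union>i\<in>absorbed c (c ` \<eta> \<omega>). c -` {i})"
    by (auto simp: absorbed_points_def)
  then show ?thesis
    using finite_subset[OF absorbed_subset_range fin_c]
    by (simp only:) (subst \<mu>.finite_measure_finite_Union, auto simp: disjoint_family_on_def)
qed

lemma measurable_card_absorbed_points[measurable]:
  "(\<lambda>\<omega>. real (card (\<eta> \<omega> \<inter> absorbed_points c \<omega>))) \<in> borel_measurable M"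
proof -
  have [measurable]: "(\<lambda>\<omega>. card (\<eta> \<omega> \<inter> c -` {i})) \<in> M \<rightarrow>\<^sub>M count_space UNIV" for i
    by (intro measurable_count sets_code_vimage)
  note [measurable] = measurable_fun_image_code
  \<comment> \<open>Summing over all cells with an indicator makes the index set independent of
    \<open>\<omega>\<close>.\<close>
  have "(\<lambda>\<omega>. \<Sum>i\<in>range c. of_bool (i \<in> absorbed c (c ` \<eta> \<omega>)) * real (card (\<eta> \<omega> \<inter> c -` {i}))) \<in> borel_measurable M"
    by measurable
  moreover have "real (card (\<eta> \<omega> \<inter> absorbed_points c \<omega>)) =
      (\<Sum>i\<in>range c. of_bool (i \<in> absorbed c (c ` \<eta> \<omega>)) * real (card (\<eta> \<omega> \<inter> c -` {i})))" if "\<omega> \<in> space M" for \<omega>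
  proof -
    have "(\<Sum>i\<in>range c. of_bool (i \<in> absorbed c (c ` \<eta> \<omega>)) * real (card (\<eta> \<omega> \<inter> c -` {i}))) =
        (\<Sum>i\<in>absorbed c (c ` \<eta> \<omega>). real (card (\<eta> \<omega> \<inter> c -` {i})))"
      using fin_c absorbed_subset_range[of c "c ` \<eta> \<omega>"] by (intro sum.mono_neutral_cong_right) auto
    then show ?thesis by (simp add: card_absorbed_points[OF that])
  qed
  ultimately show ?thesis by (subst measurable_cong) auto
qed

lemma measurable_measure_absorbed_points[measurable]:
  "(\<lambda>\<omega>. measure \<mu> (absorbed_points c \<omega>)) \<in> borel_measurable M"
  unfolding absorbed_points_def by (rule measurable_fun_image_code)

lemma mgf_absorbed_points:
  "expectation (\<lambda>\<omega>. exp (w * real (card (\<eta> \<omega> \<inter> absorbed_points c \<omega>)))) =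
   expectation (\<lambda>\<omega>. exp (t * (exp w - 1) * measure \<mu> (absorbed_points c \<omega>)))"
proof -
  let ?N = "\<lambda>i \<omega>. card (\<eta> \<omega> \<inter> c -` {i})" and ?p = "\<lambda>i. t * measure \<mu> (c -` {i})"
  have "expectation (\<lambda>\<omega>. exp (w * (\<Sum>i\<in>absorbed c {i \<in> range c. ?N i \<omega> > 0}. real (?N i \<omega>)))) =
        expectation (\<lambda>\<omega>. exp ((exp w - 1) * (\<Sum>i\<in>absorbed c {i \<in> range c. ?N i \<omega> > 0}. ?p i)))"
  proof (rule poisson_toggle_invariant_mgf)
    show "indep_vars (\<lambda>_. count_space UNIV) ?N (range c)"
      using fin_c by (intro indep_count) (auto simp: disjoint_family_on_def)
    show "prob {\<omega> \<in> space M. ?N i \<omega> = n} = exp (- ?p i) * ?p i ^ n / fact n" for i n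
      by (rule prob_count) simp
    show "absorbed c (insert i J) = absorbed c J" "absorbed c (J - {i}) = absorbed c J"
      if "J \<subseteq> range c" "i \<in> absorbed c J" for J i
      using absorbed_toggle[OF finite_subset[OF that(1) fin_c] that(2)] by auto
  qed (use t_pos fin_c absorbed_subset_range in auto)
  moreover have "exp (w * real (card (\<eta> \<omega> \<inter> absorbed_points c \<omega>))) =
      exp (w * (\<Sum>i\<in>absorbed c {i \<in> range c. ?N i \<omega> > 0}. real (?N i \<omega>)))" if "\<omega> \<in> space M" for \<omega>
    by (simp add: card_absorbed_points[OF that] image_code_eq[OF that])
  moreover have "exp (t * (exp w - 1) * measure \<mu> (absorbed_points c \<omega>)) =
      exp ((exp w - 1) * (\<Sum>i\<in>absorbed c {i \<in> range c. ?N i \<omega> > 0}. ?p i))" if "\<omega> \<in> space M" for \<omega>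
    by (simp add: measure_absorbed_points image_code_eq[OF that] sum_distrib_left mult_ac)
  ultimately show ?thesis
    by (metis (no_types, lifting) Bochner_Integration.integral_cong)
qed

end

section \<open>Passage to vanishing mesh\<close>

lemma measure_interior_convex_hull:
  assumes "finite F"
  shows "measure \<mu> (interior (convex hull F)) = measure \<mu> (convex hull F)"
proof -
  have cl: "closed (convex hull F)"
    using assms by (intro compact_imp_closed finite_imp_compact_convex_hull)
  \<comment> \<open>The frontier of a convex set is Lebesgue null; absolute continuity makes it null
    for \<open>\<mu>\<close>.\<close>
  have "frontier (convex hull F) \<in> null_sets lborel"
    using negligible_convex_frontier[OF convex_convex_hull, of F]
    by (auto simp: negligible_iff_null_sets null_sets_completion_iff)
  then have "frontier (convex hull F) \<in> null_sets \<mu>" using ac by (auto simp: absolutely_continuous_def)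
  then have "measure \<mu> (convex hull F - frontier (convex hull F)) = measure \<mu> (convex hull F)"
    using cl by (intro measure_Diff_null_set) auto
  then show ?thesis using cl by (simp add: frontier_def Diff_Diff_Int closure_closed Int_absorb1 interior_subset)
qed

definition code :: "nat \<Rightarrow> 'a \<Rightarrow> nat" where
  "code m = (SOME c. fine_code (Suc m) c)"

lemma fine_code_code: "fine_code (Suc m) (code m)"
  unfolding code_def by (rule someI_ex[OF fine_code_exists]) simp

lemma measurable_code[measurable]: "code m \<in> borel \<rightarrow>\<^sub>M count_space UNIV"
  and finite_code: "finite (range (code m))"
  using fine_code_code by (auto simp: fine_code_def)

lemma eventually_absorbed_points:
  assumes "\<omega> \<in> space M"
  shows "eventually (\<lambda>m. p \<in> absorbed_points (code m) \<omega> \<longleftrightarrow> p \<in> interior (convex hull (\<eta> \<omega>))) sequentially"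
  unfolding absorbed_points_def
  using eventually_absorbed_iff_interior[OF finite_\<eta>[OF assms] fine_code_code] by simp

text \<open>Finitely many pointwise equivalences eventually hold at once, so the count is eventually
  constant.\<close>

lemma card_absorbed_points_tendsto:
  assumes "\<omega> \<in> space M"
  shows "(\<lambda>m. real (card (\<eta> \<omega> \<inter> absorbed_points (code m) \<omega>))) \<longlonglongrightarrow>
    real (card (\<eta> \<omega> \<inter> interior (convex hull (\<eta> \<omega>))))"
proof (rule tendsto_eventually)
  have "eventually (\<lambda>m. \<forall>p\<in>\<eta> \<omega>. p \<in> absorbed_points (code m) \<omega> \<longleftrightarrow> p \<in> interior (convex hull (\<eta> \<omega>))) sequentially"
    using finite_\<eta>[OF assms] eventually_absorbed_points[OF assms] by (intro eventually_ball_finite) auto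
  then show "eventually (\<lambda>m. real (card (\<eta> \<omega> \<inter> absorbed_points (code m) \<omega>)) =
    real (card (\<eta> \<omega> \<inter> interior (convex hull (\<eta> \<omega>))))) sequentially"
    by eventually_elim (auto intro!: arg_cong[of _ _ card])
qed

text \<open>The indicators converge pointwise, so dominated convergence gives the content of the
  interior of the hull, which equals that of the hull.\<close>

lemma measure_absorbed_points_tendsto:
  assumes "\<omega> \<in> space M"
  shows "(\<lambda>m. measure \<mu> (absorbed_points (code m) \<omega>)) \<longlonglongrightarrow> measure \<mu> (convex hull (\<eta> \<omega>))"
proof -
  let ?A = "\<lambda>m. absorbed_points (code m) \<omega>" and ?B = "interior (convex hull (\<eta> \<omega>))"
  have A[measurable]: "?A m \<in> sets borel" for m
    using sets_code_vimage[OF measurable_code finite_code, of m "absorbed (code m) (code m ` \<eta> \<omega>)"]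
    by (simp add: absorbed_points_def vimage_def)
  have "(\<lambda>m. \<integral>p. indicator (?A m) p \<partial>\<mu>) \<longlonglongrightarrow> (\<integral>p. indicator ?B p \<partial>\<mu> :: real)"
  proof (rule integral_dominated_convergence[where w = "\<lambda>_. 1"])
    show "AE p in \<mu>. (\<lambda>m. indicator (?A m) p :: real) \<longlonglongrightarrow> indicator ?B p"
    proof (rule AE_I2, rule tendsto_eventually)
      fix p
      show "eventually (\<lambda>m. (indicator (?A m) p :: real) = indicator ?B p) sequentially"
        using eventually_absorbed_points[OF assms, of p] by eventually_elim (simp add: indicator_def)
    qed
  qed (auto simp: indicator_le_1 intro!: borel_measurable_indicator)
  then show ?thesis
    using measure_interior_convex_hull[OF finite_\<eta>[OF assms]] by simp
qed

text \<open>The process only provides measurable counts in fixed Borel sets; quantities of the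
  random hull are measurable as limits of their discretisations.\<close>

lemma measurable_measure_hull[measurable]:
  "(\<lambda>\<omega>. measure \<mu> (convex hull (\<eta> \<omega>))) \<in> borel_measurable M"
  by (rule borel_measurable_LIMSEQ_real[OF measure_absorbed_points_tendsto])
    (auto intro: measurable_measure_absorbed_points measurable_code finite_code)

lemma measurable_card_interior[measurable]:
  "(\<lambda>\<omega>. real (card (\<eta> \<omega> \<inter> interior (convex hull (\<eta> \<omega>))))) \<in> borel_measurable M"
  by (rule borel_measurable_LIMSEQ_real[OF card_absorbed_points_tendsto])
    (auto intro: measurable_card_absorbed_points measurable_code finite_code)

text \<open>Dominated convergence applies on both sides: to the counts by the exponential moment of
  the Poisson total count, to the contents by a constant, since \<open>\<mu>\<close> has mass
  1.\<close>

lemma mgf_card_interior: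
  "expectation (\<lambda>\<omega>. exp (w * real (card (\<eta> \<omega> \<inter> interior (convex hull (\<eta> \<omega>)))))) =
   expectation (\<lambda>\<omega>. exp (t * (exp w - 1) * measure \<mu> (convex hull (\<eta> \<omega>))))"
proof -
  note [measurable] = measurable_card_absorbed_points[OF measurable_code finite_code]
    measurable_measure_absorbed_points[OF measurable_code finite_code]
  have N[measurable]: "(\<lambda>\<omega>. card (\<eta> \<omega>)) \<in> M \<rightarrow>\<^sub>M count_space UNIV"
    using measurable_count[of UNIV] by simp
  have "integrable M (\<lambda>\<omega>. exp (\<bar>w\<bar> * real (card (\<eta> \<omega>))))"
    using poisson_exponential_moment[OF N, of "t * measure \<mu> UNIV" "\<bar>w\<bar>"] prob_count[of UNIV] t_pos
    by (auto simp: has_bochner_integral_iff)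
  then have lim1: "(\<lambda>m. expectation (\<lambda>\<omega>. exp (w * real (card (\<eta> \<omega> \<inter> absorbed_points (code m) \<omega>))))) \<longlonglongrightarrow>
      expectation (\<lambda>\<omega>. exp (w * real (card (\<eta> \<omega> \<inter> interior (convex hull (\<eta> \<omega>))))))"
  proof (rule integral_dominated_convergence[rotated 2])
    show "AE \<omega> in M. (\<lambda>m. exp (w * real (card (\<eta> \<omega> \<inter> absorbed_points (code m) \<omega>)))) \<longlonglongrightarrow>
        exp (w * real (card (\<eta> \<omega> \<inter> interior (convex hull (\<eta> \<omega>)))))"
      by (intro AE_I2 tendsto_intros card_absorbed_points_tendsto)
    fix m
    have "w * real (card (\<eta> \<omega> \<inter> A)) \<le> \<bar>w\<bar> * real (card (\<eta> \<omega>))" if "\<omega> \<in> space M" for \<omega> A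
      using card_mono[OF finite_\<eta>[OF that], of "\<eta> \<omega> \<inter> A"] by (intro mult_mono) auto
    then show "AE \<omega> in M. norm (exp (w * real (card (\<eta> \<omega> \<inter> absorbed_points (code m) \<omega>)))) \<le> exp (\<bar>w\<bar> * real (card (\<eta> \<omega>)))"
      by (intro AE_I2) auto
  qed auto
  have lim2: "(\<lambda>m. expectation (\<lambda>\<omega>. exp (t * (exp w - 1) * measure \<mu> (absorbed_points (code m) \<omega>)))) \<longlonglongrightarrow>
      expectation (\<lambda>\<omega>. exp (t * (exp w - 1) * measure \<mu> (convex hull (\<eta> \<omega>))))"
  proof (rule integral_dominated_convergence[where w = "\<lambda>_. exp \<bar>t * (exp w - 1)\<bar>"])
    show "AE \<omega> in M. (\<lambda>m. exp (t * (exp w - 1) * measure \<mu> (absorbed_points (code m) \<omega>))) \<longlonglongrightarrow>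
        exp (t * (exp w - 1) * measure \<mu> (convex hull (\<eta> \<omega>)))"
      by (intro AE_I2 tendsto_intros measure_absorbed_points_tendsto)
    have "z * measure \<mu> A \<le> \<bar>z\<bar>" for z A
      using mult_mono[of z "\<bar>z\<bar>" "measure \<mu> A" 1] by simp
    then show "AE \<omega> in M. norm (exp (t * (exp w - 1) * measure \<mu> (absorbed_points (code m) \<omega>))) \<le> exp \<bar>t * (exp w - 1)\<bar>" for m
      by simp
  qed auto
  show ?thesis
    using LIMSEQ_unique[OF lim1] lim2 mgf_absorbed_points[OF measurable_code finite_code] by simp
qed

lemma cumulant_identity:
  assumes "k \<ge> 1"
  shows "t ^ k * cumulant M (\<lambda>\<omega>. measure \<mu> (convex hull (\<eta> \<omega>))) k
       = (\<Sum>j=1..k. of_int (stirling1_signed k j) *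
            cumulant M (\<lambda>\<omega>. real (card (\<eta> \<omega> \<inter> interior (convex hull (\<eta> \<omega>))))) j)"
proof -
  define V where "V \<omega> = measure \<mu> (convex hull (\<eta> \<omega>))" for \<omega>
  have V[measurable]: "V \<in> borel_measurable M" unfolding V_def by measurable
  have V01: "0 \<le> V \<omega> \<and> V \<omega> \<le> 1" for \<omega> by (simp add: V_def)
  \<comment> \<open>Positivity makes the logarithm differentiable; as \<open>V\<close> is in the
    unit interval, \<open>exp (- \<bar>z\<bar>)\<close> is a lower bound.\<close>
  have "expectation (\<lambda>\<omega>. exp (z * V \<omega>)) > 0" for z
  proof -
    have le: "\<bar>z * V \<omega>\<bar> \<le> \<bar>z\<bar>" for \<omega> using V01[of \<omega>] by (simp add: abs_mult mult_left_le)
    then have "integrable M (\<lambda>\<omega>. exp (z * V \<omega>))"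
      by (intro integrable_const_bound[of _ "exp \<bar>z\<bar>"]) (auto intro!: AE_I2 dest: abs_le_D1)
    moreover have "exp (- \<bar>z\<bar>) \<le> exp (z * V \<omega>)" for \<omega> using le[of \<omega>] by (simp add: abs_le_iff)
    ultimately have "exp (- \<bar>z\<bar>) \<le> expectation (\<lambda>\<omega>. exp (z * V \<omega>))"
      by (intro integral_ge_const) auto
    then show ?thesis by (rule less_le_trans[OF exp_gt_zero])
  qed
  then have "times_differentiable n (\<lambda>z. ln (expectation (\<lambda>\<omega>. exp (z * V \<omega>))))" for n
    using V V01 by (intro times_differentiable_ln times_differentiable_mgf) auto
  \<comment> \<open>After the substitution, \<open>mgf_card_interior\<close> turns the logarithm of
    the generating function of \<open>V\<close> into that of the interior count.\<close>
  from higher_deriv_exp_substitution[OF this assms, of t] show ?thesis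
    by (simp add: cumulant_def mgf_card_interior V_def)
qed

end

theorem theorem3:
  fixes M :: "'w measure" and \<mu> :: "'a::euclidean_space measure"
    and t :: real and \<eta> :: "'w \<Rightarrow> 'a set" and k :: nat
  assumes "prob_space M"
    and "prob_space \<mu>" and "sets \<mu> = sets borel"
    and "absolutely_continuous lborel \<mu>"
    and "t > 0"
    and "poisson_point_process M \<mu> t \<eta>"
    and "k \<ge> 1"
  shows "t ^ k * cumulant M (\<lambda>\<omega>. measure \<mu> (convex hull (\<eta> \<omega>))) k
       = (\<Sum>j=1..k. of_int (stirling1_signed k j) *
            cumulant M (\<lambda>\<omega>. real (card (\<eta> \<omega> \<inter> interior (convex hull (\<eta> \<omega>))))) j)"
proof -
  interpret poisson_process M \<mu> t \<eta>
    using assms by (simp add: poisson_process_def poisson_process_axioms_def)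
  show ?thesis using \<open>k \<ge> 1\<close> by (rule cumulant_identity)
qed

end
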